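(* Consider $\dot x=f(x)=Ax+F_n(x)$ on $\mathbb{R}^n$ with hyperbolic equilibrium at the origin and principal Koopman eigenfunctions $\phi_\lambda(x)=w_\lambda^\top x+h_\lambda(x)$ well defined on $\mathbb{R}^n$. Assume that the nonlinear parts of the eigenfunctions are bounded: $|h_\lambda(x)|\le M$ for some constant $M$ and all $x\in\mathbb{R}^n$. Then the Koopman principal eigenfunction corresponding to eigenvalue $\lambda$ (a) with $\mathrm{Re}(\lambda)>0$ is given by $$\phi_\lambda(x)=w_\lambda^\top x+\int_0^\infty e^{-\lambda t}\,w_\lambda^\top F_n(s_t(x))\,dt;$$ (b) with $\mathrm{Re}(\lambda)<0$ is given by $$\phi_\lambda(x)=w_\lambda^\top x-\int_0^\infty e^{\lambda\theta}\,w_\lambda^\top F_n(s_{-\theta}(x))\,d\theta.$$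
   Context: $f:\mathbb{R}^n\to\mathbb{R}^n$ is smooth with $f(0)=0$; $A=\frac{\partial f}{\partial x}(0)$ and $F_n(x)=f(x)-Ax$ is the purely nonlinear part; $s_t(x)$ is the solution (flow) of $\dot x=f(x)$ at time $t$ starting from $x$, taken to be defined for all times $t\in\mathbb{R}$. $w_\lambda$ is a left eigenvector of $A$: $w_\lambda^\top A=\lambda w_\lambda^\top$. A principal Koopman eigenfunction $\phi_\lambda$ with eigenvalue $\lambda$ (an eigenvalue of $A$) is a $C^1$ function with $\frac{\partial\phi_\lambda}{\partial x}(x)f(x)=\lambda\phi_\lambda(x)$; it decomposes as $\phi_\lambda(x)=w_\lambda^\top x+h_\lambda(x)$ with $h_\lambda$ purely nonlinear, $\frac{\partial h_\lambda}{\partial x}(0)=0$, and $h_\lambda$ satisfies the linear PDE $\frac{\partial h_\lambda}{\partial x}f(x)-\lambda h_\lambda(x)+w_\lambda^\top F_n(x)=0$. The integrals over $[0,\infty)$ are understood as limits of integrals over $[0,t]$ as $t\to\infty$. *)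

theory Defs
  imports "HOL-Analysis.Analysis"
begin

text \<open>Class C^k on a finite-dimensional space: the partial derivatives are taken in all
  directions v, which on a Euclidean space amounts to differentiability with a derivative
  of class C^(k-1).\<close>

primrec C_k :: "nat \<Rightarrow> ('a::euclidean_space \<Rightarrow> 'b::real_normed_vector) \<Rightarrow> bool" where
  "C_k 0 f \<longleftrightarrow> continuous_on UNIV f"
| "C_k (Suc k) f \<longleftrightarrow>
     (\<forall>x. f differentiable (at x)) \<and> (\<forall>v. C_k k (\<lambda>x. frechet_derivative f (at x) v))"

definition smooth :: "('a::euclidean_space \<Rightarrow> 'b::real_normed_vector) \<Rightarrow> bool" where
  "smooth f \<longleftrightarrow> (\<forall>k. C_k k f)"

abbreviation complexify :: "real^'n^'m \<Rightarrow> complex^'n^'m" where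
  "complexify \<equiv> map_matrix complex_of_real"

definition eigenvalue :: "real^'n^'n \<Rightarrow> complex \<Rightarrow> bool" where
  "eigenvalue A \<mu> \<longleftrightarrow> (\<exists>v. v \<noteq> 0 \<and> complexify A *v v = \<mu> *s v)"

definition left_eigenvector :: "real^'n^'n \<Rightarrow> complex \<Rightarrow> complex^'n \<Rightarrow> bool" where
  "left_eigenvector A \<mu> w \<longleftrightarrow> w \<noteq> 0 \<and> w v* complexify A = \<mu> *s w"

definition hyperbolic_equilibrium :: "(real^'n \<Rightarrow> real^'n) \<Rightarrow> real^'n \<Rightarrow> bool" where
  "hyperbolic_equilibrium f p \<longleftrightarrow>
     f p = 0 \<and> (\<forall>\<mu>. eigenvalue (jacobian f (at p)) \<mu> \<longrightarrow> Re \<mu> \<noteq> 0)"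

text \<open>The product of the transpose of w with x, without complex conjugation of w.\<close>

definition tdot :: "complex^'n \<Rightarrow> real^'n \<Rightarrow> complex" where
  "tdot w x = (\<Sum>i\<in>UNIV. w $ i * complex_of_real (x $ i))"

definition is_flow :: "(real^'n \<Rightarrow> real^'n) \<Rightarrow> (real \<Rightarrow> real^'n \<Rightarrow> real^'n) \<Rightarrow> bool" where
  "is_flow f s \<longleftrightarrow>
     (\<forall>x. s 0 x = x) \<and>
     (\<forall>t x. ((\<lambda>\<tau>. s \<tau> x) has_vector_derivative f (s t x)) (at t))"

text \<open>The last conjunct says that the remainder of \<open>\<phi>\<close> after subtraction of its linear part
  given by w has vanishing derivative at the origin.\<close>

definition principal_koopman_eigenfunction ::
  "(real^'n \<Rightarrow> real^'n) \<Rightarrow> complex \<Rightarrow> complex^'n \<Rightarrow> (real^'n \<Rightarrow> complex) \<Rightarrow> bool" where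
  "principal_koopman_eigenfunction f \<mu> w \<phi> \<longleftrightarrow>
     eigenvalue (jacobian f (at 0)) \<mu> \<and>
     left_eigenvector (jacobian f (at 0)) \<mu> w \<and>
     C_k 1 \<phi> \<and>
     (\<forall>x. frechet_derivative \<phi> (at x) (f x) = \<mu> * \<phi> x) \<and>
     ((\<lambda>x. \<phi> x - tdot w x) has_derivative (\<lambda>_. 0)) (at 0)"

text \<open>Improper (in general only conditionally convergent) integral over the half line.\<close>

definition has_improper_integral :: "(real \<Rightarrow> complex) \<Rightarrow> complex \<Rightarrow> bool" where
  "has_improper_integral g I \<longleftrightarrow>
     (\<forall>T\<ge>0. g integrable_on {0..T}) \<and>
     ((\<lambda>T. integral {0..T} g) \<longlongrightarrow> I) at_top"

lemma tdot_add: "tdot w (x + y) = tdot w x + tdot w y"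
  by (simp add: tdot_def algebra_simps sum.distrib)

lemma bounded_linear_tdot: "bounded_linear (tdot w)"
proof -
  have "linear (tdot w)"
  proof (rule linearI)
    show "tdot w (r *\<^sub>R x) = r *\<^sub>R tdot w x" for r x
      unfolding tdot_def scaleR_sum_right
      by (rule sum.cong[OF refl])
         (simp only: vector_scaleR_component scaleR_conv_of_real[where 'a=complex] of_real_mult mult.left_commute
           real_scaleR_def)
  qed (rule tdot_add)
  then show ?thesis
    by (simp add: linear_conv_bounded_linear)
qed

lemma tdot_left_eigenvector:
  assumes "left_eigenvector A \<mu> w"
  shows "tdot w (A *v x) = \<mu> * tdot w x"
proof -
  have e: "(\<Sum>i\<in>UNIV. w $ i * complex_of_real (A $ i $ j)) = \<mu> * w $ j" for j
    using assms by (simp add: left_eigenvector_def vec_eq_iff vector_matrix_mult_def mult.commute)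
  have "tdot w (A *v x) =
      (\<Sum>i\<in>UNIV. \<Sum>j\<in>UNIV. w $ i * complex_of_real (A $ i $ j) * complex_of_real (x $ j))"
    by (simp add: tdot_def matrix_vector_mult_def sum_distrib_left mult.assoc)
  also have "\<dots> = (\<Sum>j\<in>UNIV. (\<Sum>i\<in>UNIV. w $ i * complex_of_real (A $ i $ j)) * complex_of_real (x $ j))"
    by (subst sum.swap) (simp add: sum_distrib_right)
  also have "\<dots> = \<mu> * tdot w x"
    by (simp add: e tdot_def sum_distrib_left mult.assoc)
  finally show ?thesis .
qed

text \<open>The linear PDE of the nonlinear part is a consequence of the eigenfunction equation.\<close>

lemma nonlinear_part_pde:
  assumes pk: "principal_koopman_eigenfunction f \<mu> w \<phi>"
    and f: "\<And>x. f x = jacobian f (at 0) *v x + Fn x"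
    and \<phi>: "\<And>x. \<phi> x = tdot w x + h x"
  shows "frechet_derivative h (at x) (f x) - \<mu> * h x + tdot w (Fn x) = 0"
proof -
  have h: "h = (\<lambda>x. \<phi> x - tdot w x)"
    using \<phi> by (simp add: fun_eq_iff)
  have "(\<phi> has_derivative frechet_derivative \<phi> (at x)) (at x)"
    using pk by (simp add: principal_koopman_eigenfunction_def flip: frechet_derivative_works)
  then have "(h has_derivative (\<lambda>v. frechet_derivative \<phi> (at x) v - tdot w v)) (at x)"
    unfolding h
    by (intro has_derivative_diff bounded_linear_imp_has_derivative bounded_linear_tdot)
  then have "frechet_derivative h (at x) = (\<lambda>v. frechet_derivative \<phi> (at x) v - tdot w v)"
    by (rule frechet_derivative_at[symmetric])
  then have "frechet_derivative h (at x) (f x) = \<mu> * \<phi> x - tdot w (f x)"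
    using pk by (simp add: principal_koopman_eigenfunction_def)
  moreover have "tdot w (f x) = \<mu> * tdot w x + tdot w (Fn x)"
    using pk by (subst f)
      (simp add: tdot_add tdot_left_eigenvector principal_koopman_eigenfunction_def)
  ultimately show ?thesis
    by (simp add: \<phi> algebra_simps)
qed

end

theory Submission
  imports Defs
begin

text \<open>
  By the linear PDE for \<open>h\<close>, the forcing term \<open>w\<^sup>T F\<^sub>n\<close> along a trajectory is, up to the
  integrating factor \<open>exp (- \<mu> t)\<close>, an exact derivative:
  \<open>d/dt (exp (- \<mu> t) h (s\<^sub>t x)) = - exp (- \<mu> t) w\<^sup>T F\<^sub>n (s\<^sub>t x)\<close>
  (\<open>discounted_nonlinear_part_derivative\<close>).
  Both formulas say that \<open>h x\<close> is the oriented integral of \<open>exp (- \<mu> t) w\<^sup>T F\<^sub>n (s\<^sub>t x)\<close>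
  from \<open>0\<close> to \<open>\<infinity>\<close> or to \<open>- \<infinity>\<close>.
  Integrating from \<open>0\<close> to \<open>T\<close> leaves \<open>h x\<close> and the boundary term
  \<open>exp (- \<mu> T) h (s\<^sub>T x)\<close>. As \<open>h\<close> is bounded, that term vanishes in the limit whenever the
  exponential decays, however the trajectory itself behaves: in forward time if \<open>Re \<mu> > 0\<close>,
  in backward time if \<open>Re \<mu> < 0\<close>. Both cases are thus one computation for the flow run
  with speed \<open>\<sigma> = 1\<close> or \<open>\<sigma> = - 1\<close>, where decay means \<open>\<sigma> Re \<mu> > 0\<close>.
\<close>

lemma has_improper_integral_antiderivative:
  assumes deriv: "\<And>t. (G has_vector_derivative g t) (at t)"
    and lim: "(G \<longlongrightarrow> L) at_top"
  shows "has_improper_integral g (L - G 0)"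
proof -
  have ftc: "(g has_integral G T - G 0) {0..T}" if "T \<ge> 0" for T
    using that
    by (intro fundamental_theorem_of_calculus) (auto intro: has_vector_derivative_at_within deriv)
  have "((\<lambda>T. G T - G 0) \<longlongrightarrow> L - G 0) at_top"
    by (intro tendsto_intros lim)
  moreover have "\<forall>\<^sub>F T in at_top. integral {0..T} g = G T - G 0"
    using eventually_ge_at_top[of 0] by eventually_elim (rule integral_unique[OF ftc])
  ultimately have "((\<lambda>T. integral {0..T} g) \<longlongrightarrow> L - G 0) at_top"
    by (simp add: filterlim_cong)
  then show ?thesis
    using ftc by (auto simp: has_improper_integral_def)
qed

lemma exp_decay_times_bounded_tendsto_0:
  fixes b :: "real \<Rightarrow> complex"
  assumes "Re \<nu> > 0" and "\<And>t. norm (b t) \<le> M"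
  shows "((\<lambda>t. exp (- \<nu> * of_real t) * b t) \<longlongrightarrow> 0) at_top"
proof (rule Lim_null_comparison)
  have "norm (exp (- \<nu> * of_real t) * b t) \<le> exp (- Re \<nu> * t) * M" for t
    using assms(2)[of t] by (simp add: norm_mult mult_left_mono)
  then show "\<forall>\<^sub>F t in at_top. norm (exp (- \<nu> * of_real t) * b t) \<le> exp (- Re \<nu> * t) * M"
    by simp
  have "filterlim (\<lambda>t. - Re \<nu> * t) at_bot at_top"
    using assms(1) by (intro filterlim_tendsto_neg_mult_at_bot[OF tendsto_const _ filterlim_ident]) auto
  then show "((\<lambda>t. exp (- Re \<nu> * t) * M) \<longlongrightarrow> 0) at_top"
    by (intro tendsto_mult_left_zero filterlim_compose[OF exp_at_bot])
qed

text \<open>By the product rule, the growth \<open>\<mu> h\<close> of \<open>h\<close> along the flow cancels against the derivative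
  of the integrating factor, leaving the forcing alone. Rescaling time by \<open>\<sigma>\<close> treats forward
  and backward trajectories together.\<close>

lemma discounted_nonlinear_part_derivative:
  assumes flow: "is_flow f s"
    and diff: "\<And>x. h differentiable (at x)"
    and pde: "\<And>x. frechet_derivative h (at x) (f x) - \<mu> * h x + tdot w (Fn x) = 0"
  shows "((\<lambda>t. exp (- (\<sigma> * \<mu>) * of_real t) * h (s (\<sigma> * t) x)) has_vector_derivative
      - of_real \<sigma> * (exp (- (\<sigma> * \<mu>) * of_real t) * tdot w (Fn (s (\<sigma> * t) x)))) (at t)"
    (is "((\<lambda>t. ?E t * _) has_vector_derivative _) _")
proof -
  let ?y = "s (\<sigma> * t) x"
  have s: "((\<lambda>t. s (\<sigma> * t) x) has_vector_derivative \<sigma> *\<^sub>R f ?y) (at t)"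
  proof -
    have "((\<lambda>t. \<sigma> * t) has_vector_derivative \<sigma>) (at t)"
      by (auto intro!: derivative_eq_intros)
    moreover have "((\<lambda>\<tau>. s \<tau> x) has_vector_derivative f ?y) (at (\<sigma> * t))"
      using flow by (simp add: is_flow_def)
    ultimately show ?thesis
      using vector_diff_chain_at[of "\<lambda>t. \<sigma> * t" \<sigma> t "\<lambda>\<tau>. s \<tau> x"] by (simp add: o_def)
  qed
  have Dh: "(h has_derivative frechet_derivative h (at ?y)) (at ?y)"
    using diff by (simp flip: frechet_derivative_works)
  then have "((\<lambda>t. h (s (\<sigma> * t) x)) has_vector_derivative
      frechet_derivative h (at ?y) (\<sigma> *\<^sub>R f ?y)) (at t)"
    using vector_derivative_diff_chain_within[OF s has_derivative_at_withinI] by (simp add: o_def)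
  moreover have "frechet_derivative h (at ?y) (\<sigma> *\<^sub>R f ?y) = \<sigma> *\<^sub>R (\<mu> * h ?y - tdot w (Fn ?y))"
  proof -
    have "frechet_derivative h (at ?y) (f ?y) = \<mu> * h ?y - tdot w (Fn ?y)"
      using pde[of ?y] by (simp add: algebra_simps eq_neg_iff_add_eq_0)
    then show ?thesis
      by (simp add: linear_scale[OF has_derivative_linear[OF Dh]])
  qed
  ultimately have "((\<lambda>t. h (s (\<sigma> * t) x)) has_vector_derivative
      \<sigma> *\<^sub>R (\<mu> * h ?y - tdot w (Fn ?y))) (at t)"
    by simp
  moreover have "(?E has_vector_derivative - (\<sigma> * \<mu>) * ?E t) (at t)"
    by (rule has_vector_derivative_real_field) (auto intro!: derivative_eq_intros)
  ultimately have "((\<lambda>t. ?E t * h (s (\<sigma> * t) x)) has_vector_derivative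
      ?E t * (\<sigma> *\<^sub>R (\<mu> * h ?y - tdot w (Fn ?y))) + (- (\<sigma> * \<mu>) * ?E t) * h ?y) (at t)"
    by (intro has_vector_derivative_mult)
  then show ?thesis
    by (simp add: scaleR_conv_of_real algebra_simps)
qed

lemma discounted_forcing_improper_integral:
  assumes flow: "is_flow f s"
    and diff: "\<And>x. h differentiable (at x)"
    and pde: "\<And>x. frechet_derivative h (at x) (f x) - \<mu> * h x + tdot w (Fn x) = 0"
    and bounded: "\<And>x. norm (h x) \<le> M"
    and decay: "\<sigma> * Re \<mu> > 0"
  shows "has_improper_integral
      (\<lambda>t. - of_real \<sigma> * (exp (- (\<sigma> * \<mu>) * of_real t) * tdot w (Fn (s (\<sigma> * t) x)))) (- h x)"
proof -
  have "((\<lambda>t. exp (- (\<sigma> * \<mu>) * of_real t) * h (s (\<sigma> * t) x)) \<longlongrightarrow> 0) at_top"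
    using decay bounded by (intro exp_decay_times_bounded_tendsto_0) auto
  from has_improper_integral_antiderivative[OF discounted_nonlinear_part_derivative[OF flow diff pde] this]
  show ?thesis
    using flow by (simp add: is_flow_def)
qed

lemma has_improper_integral_uminus:
  "has_improper_integral g I \<Longrightarrow> has_improper_integral (\<lambda>t. - g t) (- I)"
  by (auto simp: has_improper_integral_def integrable_neg intro: tendsto_minus)

lemma nonlinear_part_differentiable:
  assumes "principal_koopman_eigenfunction f \<mu> w \<phi>"
    and "\<And>x. \<phi> x = tdot w x + h x"
  shows "h differentiable (at x)"
proof -
  have "h = (\<lambda>x. \<phi> x - tdot w x)"
    using assms(2) by (simp add: fun_eq_iff)
  moreover have "\<phi> differentiable (at x)"
    using assms(1) by (simp add: principal_koopman_eigenfunction_def)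
  ultimately show ?thesis
    by (simp add: differentiable_diff bounded_linear_imp_differentiable[OF bounded_linear_tdot])
qed

theorem theorem9:
  fixes f Fn :: "real^'n \<Rightarrow> real^'n" and A :: "real^'n^'n"
    and s :: "real \<Rightarrow> real^'n \<Rightarrow> real^'n"
    and \<mu> :: complex and w :: "complex^'n" and \<phi> h :: "real^'n \<Rightarrow> complex" and M :: real
  assumes "smooth f"
    and "hyperbolic_equilibrium f 0"
    and "A = jacobian f (at 0)"
    and "\<And>x. f x = A *v x + Fn x"
    and "is_flow f s"
    and "principal_koopman_eigenfunction f \<mu> w \<phi>"
    and "\<And>x. \<phi> x = tdot w x + h x"
    and "\<And>x. norm (h x) \<le> M"
  shows "(Re \<mu> > 0 \<longrightarrow>
           (\<forall>x. \<exists>I. has_improper_integral (\<lambda>t. exp (- \<mu> * complex_of_real t) * tdot w (Fn (s t x))) I \<and>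
                    \<phi> x = tdot w x + I)) \<and>
         (Re \<mu> < 0 \<longrightarrow>
           (\<forall>x. \<exists>I. has_improper_integral (\<lambda>\<theta>. exp (\<mu> * complex_of_real \<theta>) * tdot w (Fn (s (- \<theta>) x))) I \<and>
                    \<phi> x = tdot w x - I))"
proof -
  have pde: "frechet_derivative h (at x) (f x) - \<mu> * h x + tdot w (Fn x) = 0" for x
    using assms(3,4) by (intro nonlinear_part_pde[OF assms(6) _ assms(7)]) simp
  note integral = discounted_forcing_improper_integral
    [OF assms(5) nonlinear_part_differentiable[OF assms(6,7)] pde assms(8)]
  \<comment> \<open>The derivative carries the factor \<open>- \<sigma>\<close>, so only forward time needs a change of sign.\<close>
  have "has_improper_integral (\<lambda>t. exp (- \<mu> * of_real t) * tdot w (Fn (s t x))) (h x)"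
    if "Re \<mu> > 0" for x
    using has_improper_integral_uminus[OF integral[of 1 x]] that by simp
  moreover have "has_improper_integral (\<lambda>\<theta>. exp (\<mu> * of_real \<theta>) * tdot w (Fn (s (- \<theta>) x))) (- h x)"
    if "Re \<mu> < 0" for x
    using integral[of "- 1" x] that by simp
  moreover have "\<phi> x = tdot w x - (- h x)" for x
    using assms(7) by simp
  ultimately show ?thesis
    using assms(7) by blast
qed

end
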